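(* Suppose that $\theta=\theta_1>1$ is an algebraic integer which has at least one (Galois) conjugate $\theta_2\neq\theta$ satisfying $|\theta_2|>1$. Then there exist $C>0$ and $\alpha,\beta>0$ such that $$\exp\Bigl(-\sum_{k=0}^{N-1}\|t\theta^k\|^2\Bigr)\le C\bigl(\log(1+t)\bigr)^{1/\log\beta}N^{-\alpha}\qquad\text{for all } t\ge1,\ N\ge1,$$ and $$\exp\Bigl(-\sum_{k=0}^{N-1}\|t\theta^k\|^2\Bigr)\le C N^{-\alpha}\qquad\text{for all } t\in(0,1),\ N\ge2\Bigl\lceil\frac{\log(1/t)}{\log\theta}\Bigr\rceil .$$ In fact, one can take $$\alpha=\frac{(1+sH)^{-2}}{\log\beta},\qquad \beta=1+\Bigl\lceil \frac{s\log\theta}{\log|\theta_2|}\Bigr\rceil,$$ where $H$ is the height of the minimal polynomial of $\theta$ and $s$ is its degree.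
   Context: For $x\in\mathbb R$, $\|x\|:=\mathrm{dist}(x,\mathbb Z)$. The height of a polynomial is the maximum of the absolute values of its coefficients. $N$ is an integer; the constant $C$ depends only on $\theta$ (not on $t$ or $N$). *)

theory Defs
  imports "HOL-Analysis.Analysis"
begin

text \<open>The minimal polynomial over the rationals; it is meaningful for algebraic \<open>x\<close> only,
  see \<open>ex1_min_poly\<close> below.\<close>

definition min_poly :: "'a::field_char_0 \<Rightarrow> rat poly" where
  "min_poly x = (THE p. irreducible p \<and> lead_coeff p = 1 \<and> poly (map_poly of_rat p) x = 0)"

text \<open>The conjugates of a real number are complex in general, hence the two types.
  Every algebraic number is a conjugate of itself.\<close>

definition galois_conjugate :: "'a::field_char_0 \<Rightarrow> 'b::field_char_0 \<Rightarrow> bool" where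
  "galois_conjugate x y \<longleftrightarrow> poly (map_poly of_rat (min_poly x)) y = 0"

definition poly_height :: "'a::linordered_idom poly \<Rightarrow> 'a" where
  "poly_height p = Max ((\<lambda>i. \<bar>coeff p i\<bar>) ` {..degree p})"

definition dist_int :: "real \<Rightarrow> real" where
  "dist_int x = infdist x \<int>"

definition conj_beta :: "real \<Rightarrow> complex \<Rightarrow> real" where
  "conj_beta \<theta> \<theta>\<^sub>2 = 1 + of_int \<lceil>real (degree (min_poly \<theta>)) * ln \<theta> / ln (norm \<theta>\<^sub>2)\<rceil>"

definition conj_alpha :: "real \<Rightarrow> complex \<Rightarrow> real" where
  "conj_alpha \<theta> \<theta>\<^sub>2 =
     (1 + real (degree (min_poly \<theta>)) * of_rat (poly_height (min_poly \<theta>))) powi (-2)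
       / ln (conj_beta \<theta> \<theta>\<^sub>2)"

definition decay_bounds :: "real \<Rightarrow> real \<Rightarrow> real \<Rightarrow> real \<Rightarrow> bool" where
  "decay_bounds \<theta> C \<alpha> \<beta> \<longleftrightarrow>
     (\<forall>(t::real) (N::nat). t \<ge> 1 \<and> N \<ge> 1 \<longrightarrow>
        exp (- (\<Sum>k<N. (dist_int (t * \<theta> ^ k))\<^sup>2))
          \<le> C * (ln (1 + t)) powr (1 / ln \<beta>) * real N powr (-\<alpha>)) \<and>
     (\<forall>(t::real) (N::nat). 0 < t \<and> t < 1 \<and> int N \<ge> 2 * \<lceil>ln (1 / t) / ln \<theta>\<rceil> \<longrightarrow>
        exp (- (\<Sum>k<N. (dist_int (t * \<theta> ^ k))\<^sup>2)) \<le> C * real N powr (-\<alpha>))"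

lemma poly_map_of_rat_add:
  "poly (map_poly of_rat (p + q)) x = poly (map_poly of_rat p) x + poly (map_poly of_rat q) (x::'a::field_char_0)"
proof -
  have "map_poly of_rat (p + q) = map_poly of_rat p + (map_poly of_rat q :: 'a poly)"
    by (rule poly_eqI) (simp add: coeff_map_poly of_rat_add)
  then show ?thesis by simp
qed

lemma poly_map_of_rat_mult:
  "poly (map_poly of_rat (p * q)) x = poly (map_poly of_rat p) x * poly (map_poly of_rat q) (x::'a::field_char_0)"
proof -
  have "map_poly of_rat (p * q) = map_poly of_rat p * (map_poly of_rat q :: 'a poly)"
    by (rule poly_eqI) (simp add: coeff_map_poly coeff_mult of_rat_sum of_rat_mult)
  then show ?thesis by simp
qed

lemma ex1_min_poly:
  fixes x :: "'a::field_char_0"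
  assumes "algebraic x"
  shows "\<exists>!p. irreducible p \<and> lead_coeff p = 1 \<and> poly (map_poly of_rat p) x = 0"
proof -
  define P where "P = (\<lambda>p. poly (map_poly of_rat p) x = 0)"
  have P_unit: "\<not> P p" if "is_unit p" for p
  proof -
    have "p \<noteq> 0" using that by auto
    then have "degree p = 0" using that by (simp add: is_unit_iff_degree)
    then obtain c where "p = [:c:]" by (rule degree_eq_zeroE)
    with \<open>p \<noteq> 0\<close> have "p = [:c:]" "c \<noteq> 0" by auto
    then show ?thesis by (simp add: P_def map_poly_pCons)
  qed
  obtain q where q: "\<And>i. coeff q i \<in> \<int>" "q \<noteq> 0" "poly q x = 0"
    using assms unfolding algebraic_def by blast
  from q(1) have "\<forall>i. \<exists>c. coeff q i = of_int c" by (auto elim: Ints_cases)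
  then obtain c where c: "\<And>i. coeff q i = of_int (c i)" by metis
  define p where "p = Poly (map (\<lambda>i. rat_of_int (c i)) [0..<Suc (degree q)])"
  have cp: "coeff p i = of_int (c i)" for i
  proof (cases "i \<le> degree q")
    case True
    then show ?thesis by (simp add: p_def nth_default_def del: upt_Suc)
  next
    case False
    then have "coeff q i = 0" by (simp add: coeff_eq_0)
    with c[of i] False show ?thesis by (simp add: p_def nth_default_def del: upt_Suc)
  qed
  have pq: "map_poly of_rat p = q" by (rule poly_eqI) (simp add: coeff_map_poly cp c)
  have p: "p \<noteq> 0" "P p" using q pq by (auto simp: P_def)
  obtain r where r: "r \<noteq> 0" "P r" and r_min: "\<And>q. q \<noteq> 0 \<Longrightarrow> P q \<Longrightarrow> degree r \<le> degree q"
    using ex_has_least_nat[of "\<lambda>q. q \<noteq> 0 \<and> P q" p degree] p by blast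
  define s where "s = smult (inverse (lead_coeff r)) r"
  have s: "s \<noteq> 0" "lead_coeff s = 1" and deg_s: "degree s = degree r" using r(1) by (auto simp: s_def)
  have P_s: "P s"
    using r(2) poly_map_of_rat_mult[of "[:inverse (lead_coeff r):]" r x] by (simp add: P_def s_def)
  have s_min: "degree s \<le> degree q" if "q \<noteq> 0" "P q" for q
    using r_min that deg_s by simp
  have "irreducible s"
  proof (rule irreducibleI)
    show "\<not> is_unit s" using P_unit P_s by blast
    fix a b assume ab: "s = a * b"
    then have nz: "a \<noteq> 0" "b \<noteq> 0" using s(1) by auto
    have "P a \<or> P b" using P_s ab by (auto simp: P_def poly_map_of_rat_mult)
    then have "degree s \<le> degree a \<or> degree s \<le> degree b" using s_min nz by blast
    then have "degree a = 0 \<or> degree b = 0" using ab nz by (auto simp: degree_mult_eq)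
    then show "is_unit a \<or> is_unit b" using nz by (auto simp: is_unit_iff_degree)
  qed (rule s(1))
  show ?thesis
  proof (rule ex1I[of _ s])
    show "irreducible s \<and> lead_coeff s = 1 \<and> poly (map_poly of_rat s) x = 0"
      using \<open>irreducible s\<close> s(2) P_s by (simp add: P_def)
    fix u assume "irreducible u \<and> lead_coeff u = 1 \<and> poly (map_poly of_rat u) x = 0"
    then have u: "irreducible u" "lead_coeff u = 1" "P u" by (auto simp: P_def)
    have "P (u mod s)"
    proof -
      have "poly (map_poly of_rat u) x = poly (map_poly of_rat (u div s * s + u mod s)) x" by simp
      also have "\<dots> = poly (map_poly of_rat (u mod s)) x"
        using P_s unfolding poly_map_of_rat_add poly_map_of_rat_mult by (simp add: P_def)
      finally show ?thesis using u(3) by (simp add: P_def)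
    qed
    then have "u mod s = 0"
      using s_min[of "u mod s"] degree_mod_less[OF s(1), of u] by fastforce
    then obtain v where v: "u = s * v" by (auto elim: dvdE)
    then have "is_unit v" using u(1) P_unit[of s] P_s by (auto dest: irreducibleD)
    moreover have "v \<noteq> 0" using v u(2) by auto
    ultimately obtain c where c: "v = [:c:]" by (metis is_unit_iff_degree degree_eq_zeroE)
    then have "c = 1" using v u(2) s(2) by (simp split: if_splits)
    then show "u = s" using v c by simp
  qed
qed

end

theory Submission
  imports Defs "Subresultants.Subresultant_Gcd" "HOL-Computational_Algebra.Field_as_Ring"
begin

text \<open>
  Let \<open>P\<close> be the minimal polynomial of \<open>\<theta>\<close>, of degree \<open>s\<close> and height \<open>H\<close>, and write
  \<open>t \<theta>\<^sup>k = m\<^sub>k + \<epsilon>\<^sub>k\<close> with \<open>m\<^sub>k\<close> the nearest integer. As long as \<open>\<bar>\<epsilon>\<^sub>k\<bar> < \<delta> = 1 / (1 + s H)\<close>, the integers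
  \<open>m\<^sub>k\<close> obey the linear recurrence with characteristic polynomial \<open>P\<close>. Applying \<open>P(x) / (x - \<theta>\<^sub>2)\<close>
  to the shift of \<open>m\<close> gives a sequence \<open>y\<^sub>k\<close> with \<open>y\<^sub>k\<^sub>+\<^sub>1 = \<theta>\<^sub>2 y\<^sub>k\<close>; since this operator annihilates \<open>t \<theta>\<^sup>k\<close>,
  \<open>y\<^sub>k\<close> depends on the \<open>\<epsilon>\<^sub>k\<close> only and is bounded. On the other hand \<open>y\<^sub>k = Q(\<theta>\<^sub>2)\<close> for a nonzero
  integer polynomial \<open>Q\<close> of degree less than \<open>s\<close> and height \<open>O(t \<theta>\<^sup>k)\<close>, and the resultant of \<open>P\<close> and
  \<open>Q\<close> being a nonzero integer yields \<open>\<bar>y\<^sub>k\<bar> \<ge> c (t \<theta>\<^sup>k)\<^sup>1\<^sup>-\<^sup>s\<close>. Hence a stretch of small \<open>\<epsilon>\<^sub>k\<close> starting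
  at \<open>A\<close> ends before \<open>\<beta> A + O(log (1 + t))\<close>, so at least \<open>log\<^sub>\<beta> (N / log (1 + t)) - O(1)\<close> indices below
  \<open>N\<close> contribute \<open>\<delta>\<^sup>2\<close> to the sum.
\<close>

section \<open>A lower bound for integer polynomials at an algebraic number\<close>

text \<open>Each of the n! terms of the Leibniz expansion takes one entry from every row. The bound
  may vary by row because Sylvester rows come from two polynomials.\<close>

lemma norm_det_le:
  fixes A :: "'a::real_normed_field mat"
  assumes A: "A \<in> carrier_mat n n"
    and b: "\<And>i j. i < n \<Longrightarrow> j < n \<Longrightarrow> norm (A $$ (i, j)) \<le> b i"
  shows "norm (Determinant.det A) \<le> fact n * (\<Prod>i<n. b i)"
proof -
  have "norm (Determinant.det A) \<le> (\<Sum>p | p permutes {0..<n}. norm (signof p * (\<Prod>i = 0..<n. A $$ (i, p i))))"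
    unfolding det_def'[OF A] by (rule norm_sum)
  also have "\<dots> \<le> (\<Sum>p | p permutes {0..<n}. \<Prod>i<n. b i)"
  proof (rule sum_mono)
    fix p assume "p \<in> {p. p permutes {0..<n}}"
    then have p: "p i < n" if "i < n" for i
      using that permutes_in_image[of p "{0..<n}" i] by auto
    have "norm (signof p * (\<Prod>i = 0..<n. A $$ (i, p i))) = (\<Prod>i = 0..<n. norm (A $$ (i, p i)))"
      by (simp add: norm_mult sign_def prod_norm)
    also have "\<dots> \<le> (\<Prod>i = 0..<n. b i)"
      using b p by (intro prod_mono) auto
    finally show "norm (signof p * (\<Prod>i = 0..<n. A $$ (i, p i))) \<le> (\<Prod>i<n. b i)"
      by (simp add: atLeast0LessThan)
  qed
  also have "\<dots> = fact n * (\<Prod>i<n. b i)"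
    by (simp add: card_permutations[of "{0..<n}" n])
  finally show ?thesis .
qed

text \<open>The Sylvester matrix sends the vector of powers of \<open>z\<close> to multiples of
  \<open>poly p z = 0\<close> and of \<open>poly q z\<close>; pairing with the last row of the
  adjugate recovers the determinant. This is the Bezout identity for the resultant, evaluated at
  \<open>z\<close>.\<close>

lemma resultant_bezout:
  fixes p q :: "'a::comm_ring_1 poly"
  defines "S \<equiv> sylvester_mat p q" and "d \<equiv> degree p + degree q"
  assumes pz: "poly p z = 0" and d: "d > 0"
  shows "resultant p q = poly q z * (\<Sum>j<degree p. cofactor S (d - 1 - j) (d - 1) * z ^ j)"
proof -
  let ?m = "degree p" and ?n = "degree q"
  have S: "S \<in> carrier_mat d d" unfolding S_def d_def by (rule sylvester_carrier_mat)
  have row: "(\<Sum>j<d. S $$ (i, j) * z ^ (d - 1 - j)) =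
      (if i < ?n then 0 else z ^ (d - 1 - i) * poly q z)" if i: "i < d" for i
  proof -
    \<comment> \<open>Row \<open>i\<close> of \<open>S\<close> lists the coefficients of
      \<open>u\<close>, highest degree first.\<close>
    define u where "u = (if i < ?n then monom 1 (?n - 1 - i) * p else monom 1 (d - 1 - i) * q)"
    have du: "degree u < d"
    proof -
      have "degree u \<le> (if i < ?n then ?n - 1 - i + ?m else d - 1 - i + ?n)"
        unfolding u_def using degree_mult_le[of "monom 1 (?n - 1 - i)" p] degree_mult_le[of "monom 1 (d - 1 - i)" q]
        by (auto simp: degree_monom_eq split: if_splits)
      then show ?thesis using i d by (auto simp: d_def split: if_splits)
    qed
    have ent: "S $$ (i, j) = coeff u (d - 1 - j)" if j: "j < d" for j
    proof (cases "i < ?n")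
      case True
      have "S $$ (i, j) = (if i \<le> j \<and> j - i \<le> ?m then coeff p (?m + i - j) else 0)"
        using i j True unfolding S_def d_def by (subst sylvester_index_mat) simp_all
      moreover have "coeff u (d - 1 - j) = (if ?n - 1 - i \<le> d - 1 - j then coeff p (d - 1 - j - (?n - 1 - i)) else 0)"
        using True by (simp add: u_def coeff_monom_mult)
      moreover have "?n - 1 - i \<le> d - 1 - j \<longleftrightarrow> j \<le> ?m + i" using i j True unfolding d_def by linarith
      moreover have "d - 1 - j - (?n - 1 - i) = ?m + i - j" using i j True unfolding d_def by linarith
      moreover have "coeff p (?m + i - j) = 0" if "\<not> i \<le> j" using that by (intro coeff_eq_0) linarith
      ultimately show ?thesis by (cases "i \<le> j"; cases "j \<le> ?m + i") simp_all
    next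
      case False
      have e1: "S $$ (i, j) = (if i - ?n \<le> j \<and> j \<le> i then coeff q (i - j) else 0)"
        using i j False unfolding S_def d_def by (subst sylvester_index_mat) simp_all
      have e2: "coeff u (d - 1 - j) = (if d - 1 - i \<le> d - 1 - j then coeff q (d - 1 - j - (d - 1 - i)) else 0)"
        using False by (simp add: u_def coeff_monom_mult)
      have e3: "d - 1 - i \<le> d - 1 - j \<longleftrightarrow> j \<le> i" using i j by linarith
      have e4: "d - 1 - j - (d - 1 - i) = i - j" using i j by linarith
      have e5: "coeff q (i - j) = 0" if "\<not> i - ?n \<le> j" using that by (intro coeff_eq_0) linarith
      show ?thesis unfolding e1 e2 e3 e4 using e5 by auto
    qed
    have "(\<Sum>j<d. S $$ (i, j) * z ^ (d - 1 - j)) = (\<Sum>j<d. coeff u (d - Suc j) * z ^ (d - Suc j))"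
      by (rule sum.cong) (auto simp: ent)
    also have "\<dots> = (\<Sum>j<d. coeff u j * z ^ j)"
      by (rule sum.nat_diff_reindex[of "\<lambda>j. coeff u j * z ^ j"])
    also have "\<dots> = poly u z"
      unfolding poly_altdef using du by (intro sum.mono_neutral_right) (auto simp: coeff_eq_0)
    finally show ?thesis by (simp add: u_def pz poly_monom)
  qed
  have delta: "(\<Sum>i<d. cofactor S i (d - 1) * S $$ (i, j)) = (if j = d - 1 then Determinant.det S else 0)"
    if j: "j < d" for j
  proof -
    have "(adj_mat S * S) $$ (d - 1, j) = (\<Sum>i<d. cofactor S i (d - 1) * S $$ (i, j))"
      using d j S unfolding times_mat_def scalar_prod_def adj_mat_def by (auto intro: sum.cong simp: atLeast0LessThan)
    then show ?thesis using adj_mat(3)[OF S] d j by auto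
  qed
  \<comment> \<open>Only the last entry \<open>z ^ 0\<close> of the power vector picks up the
    determinant.\<close>
  have "Determinant.det S = (\<Sum>j<d. (if j = d - 1 then Determinant.det S else 0) * z ^ (d - 1 - j))"
    using d by (simp add: if_distrib[of "\<lambda>x. x * _"] cong: if_cong)
  also have "\<dots> = (\<Sum>j<d. (\<Sum>i<d. cofactor S i (d - 1) * S $$ (i, j)) * z ^ (d - 1 - j))"
    using delta by (intro sum.cong) auto
  also have "\<dots> = (\<Sum>i<d. cofactor S i (d - 1) * (\<Sum>j<d. S $$ (i, j) * z ^ (d - 1 - j)))"
    unfolding sum_distrib_right sum_distrib_left by (subst sum.swap) (simp add: mult_ac)
  also have "\<dots> = (\<Sum>i<d. if i < ?n then 0 else poly q z * (cofactor S i (d - 1) * z ^ (d - 1 - i)))"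
    by (intro sum.cong refl) (simp only: row lessThan_iff, simp add: mult_ac)
  also have "\<dots> = (\<Sum>i = ?n..<d. poly q z * (cofactor S i (d - 1) * z ^ (d - 1 - i)))"
    by (intro sum.mono_neutral_cong_right) auto
  also have "\<dots> = (\<Sum>j<?m. poly q z * (cofactor S (d - 1 - j) (d - 1) * z ^ j))"
    by (rule sum.reindex_bij_witness[where i = "\<lambda>j. d - 1 - j" and j = "\<lambda>i. d - 1 - i"]) (auto simp: d_def)
  finally show ?thesis by (simp add: resultant_def S_def sum_distrib_left)
qed

text \<open>The cofactors in \<open>resultant_bezout\<close> delete a row belonging to
  \<open>q\<close>, so \<open>n\<close> rows of \<open>p\<close> and \<open>m - 1\<close> rows of
  \<open>q\<close> remain; hence the two exponents.\<close>

lemma norm_resultant_le: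
  fixes p q :: "'a::real_normed_field poly"
  defines "m \<equiv> degree p" and "n \<equiv> degree q"
  assumes pz: "poly p z = 0" and m: "m > 0"
    and a: "\<And>i. norm (coeff p i) \<le> a" and b: "\<And>i. norm (coeff q i) \<le> b"
  shows "norm (resultant p q) \<le> norm (poly q z) * (fact (m + n - 1) * a ^ n * b ^ (m - 1) * (\<Sum>j<m. norm z ^ j))"
proof -
  let ?S = "sylvester_mat p q" and ?d = "m + n"
  have a0: "0 \<le> a" using a[of 0] norm_ge_zero order_trans by blast
  have b0: "0 \<le> b" using b[of 0] norm_ge_zero order_trans by blast
  have cof: "norm (cofactor ?S (?d - 1 - j) (?d - 1)) \<le> fact (?d - 1) * a ^ n * b ^ (m - 1)" if j: "j < m" for j
  proof -
    let ?D = "mat_delete ?S (?d - 1 - j) (?d - 1)"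
    have D: "?D \<in> carrier_mat (?d - 1) (?d - 1)"
      unfolding m_def n_def by (rule mat_delete_carrier[OF sylvester_carrier_mat])
    have "norm (?D $$ (k, l)) \<le> (if k < n then a else b)" if kl: "k < ?d - 1" "l < ?d - 1" for k l
    proof -
      \<comment> \<open>\<open>k'\<close> is the row of the full matrix that becomes row
        \<open>k\<close> of the minor.\<close>
      define k' where "k' = (if k < ?d - 1 - j then k else Suc k)"
      have k': "k' < ?d" "k' < n \<longleftrightarrow> k < n" using kl j by (auto simp: k'_def)
      have "?D $$ (k, l) = ?S $$ (k', l)"
        using kl by (simp add: mat_delete_def k'_def m_def n_def)
      also have "norm \<dots> \<le> (if k' < n then a else b)"
        using k'(1) kl a b a0 b0 unfolding m_def n_def by (auto simp: sylvester_index_mat)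
      finally show ?thesis using k'(2) by simp
    qed
    then have "norm (Determinant.det ?D) \<le> fact (?d - 1) * (\<Prod>k<?d - 1. if k < n then a else b)"
      by (rule norm_det_le[OF D])
    also have "(\<Prod>k<?d - 1. if k < n then a else b) = (\<Prod>k<n. a) * (\<Prod>k\<in>{n..<?d - 1}. b)"
    proof -
      have "{..<?d - 1} \<inter> {k. k < n} = {..<n}" "{..<?d - 1} \<inter> - {k. k < n} = {n..<?d - 1}"
        using m by auto
      then show ?thesis by (simp add: prod.If_cases)
    qed
    also have "\<dots> = a ^ n * b ^ (m - 1)" using m by (simp add: algebra_simps)
    finally show ?thesis by (simp add: cofactor_def norm_mult norm_power mult.assoc)
  qed
  have "resultant p q = poly q z * (\<Sum>j<m. cofactor ?S (?d - 1 - j) (?d - 1) * z ^ j)"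
    using resultant_bezout[OF pz, of q] m unfolding m_def n_def by simp
  also have "norm \<dots> \<le> norm (poly q z) * (\<Sum>j<m. (fact (?d - 1) * a ^ n * b ^ (m - 1)) * norm z ^ j)"
    unfolding norm_mult
    by (intro mult_left_mono sum_norm_le) (auto simp: norm_mult norm_power intro!: mult_right_mono cof[simplified])
  finally show ?thesis by (simp flip: sum_distrib_left)
qed

text \<open>A zero resultant gives a nonconstant common factor. Irreducibility over the rationals
  makes its cofactor in \<open>p\<close> constant, so the factor has the degree of \<open>p\<close>,
  too large to divide \<open>q\<close>.\<close>

lemma resultant_of_int_irreducible_neq_0:
  fixes p q :: "int poly"
  assumes irr: "irreducible (of_int_poly p :: rat poly)"
    and q: "q \<noteq> 0" "degree q < degree p"
  shows "resultant p q \<noteq> 0"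
proof
  assume "resultant p q = 0"
  then have deg: "degree (gcd p q) \<noteq> 0" by (simp add: resultant_0_gcd)
  obtain r where r: "p = gcd p q * r" by (metis dvd_def gcd_dvd1)
  then have "(of_int_poly p :: rat poly) = of_int_poly (gcd p q) * of_int_poly r"
    by (metis of_int_poly_hom.hom_mult)
  then have "is_unit (of_int_poly (gcd p q) :: rat poly) \<or> is_unit (of_int_poly r :: rat poly)"
    using irr by (auto dest: irreducibleD)
  then have "degree r = 0" using deg by (auto simp: is_unit_iff_degree poly_dvd_1)
  have "p \<noteq> 0" using q by auto
  then have "degree p = degree (gcd p q) + degree r" using r by (metis degree_mult_eq mult_eq_0_iff)
  moreover have "degree (gcd p q) \<le> degree q" using q by (intro dvd_imp_degree_le) auto
  ultimately show False using \<open>degree r = 0\<close> q by simp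
qed

text \<open>The resultant of \<open>p\<close> and \<open>q\<close> is a nonzero integer, so its
  modulus is at least 1, while \<open>norm_resultant_le\<close> bounds it by a multiple of
  |q(z)|.\<close>

lemma int_poly_root_lower_bound:
  fixes p :: "int poly" and z :: complex
  assumes irr: "irreducible (of_int_poly p :: rat poly)"
    and pz: "poly (of_int_poly p) z = 0"
  shows "\<exists>c>0. \<forall>(q::int poly) b. q \<noteq> 0 \<and> degree q < degree p \<and> (\<forall>i. \<bar>real_of_int (coeff q i)\<bar> \<le> b)
      \<longrightarrow> 1 \<le> c * b ^ (degree p - 1) * norm (poly (of_int_poly q) z)"
proof -
  let ?m = "degree p"
  define a where "a = (\<Sum>i\<le>?m. norm (of_int (coeff p i) :: complex))"
  define c where "c n = fact (?m + n - 1) * a ^ n * (\<Sum>j<?m. norm z ^ j)" for n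
  have a: "norm (coeff (of_int_poly p :: complex poly) i) \<le> a" for i
  proof (cases "i \<le> ?m")
    case True
    then show ?thesis unfolding a_def by (auto intro!: member_le_sum)
  next
    case False
    then show ?thesis by (auto simp: a_def coeff_eq_0 intro!: sum_nonneg)
  qed
  have c: "c n \<ge> 0" for n unfolding c_def a_def by (intro mult_nonneg_nonneg zero_le_power sum_nonneg) auto
  show ?thesis
  \<comment> \<open>The resultant bound depends on \<open>degree q\<close>; summing over all degrees
    below \<open>?m\<close> makes it uniform, and the added 1 makes it positive.\<close>
  proof (intro exI[of _ "1 + (\<Sum>n<?m. c n)"] conjI allI impI; (elim conjE)?)
    show "0 < 1 + (\<Sum>n<?m. c n)" using sum_nonneg[of "{..<?m}" c] c by simp
    fix q :: "int poly" and b :: real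
    assume q: "q \<noteq> 0" "degree q < ?m" and b: "\<forall>i. \<bar>real_of_int (coeff q i)\<bar> \<le> b"
    have b0: "b \<ge> 0" using b by (meson abs_ge_zero order_trans)
    have "1 \<le> \<bar>resultant p q\<bar>"
      using resultant_of_int_irreducible_neq_0[OF irr q] by linarith
    then have "1 \<le> norm (of_int (resultant p q) :: complex)"
      by (simp add: norm_of_int)
    also have "\<dots> = norm (resultant (of_int_poly p) (of_int_poly q) :: complex)"
      by (simp add: of_int_hom.resultant_hom)
    also have "\<dots> \<le> norm (poly (of_int_poly q) z) * (c (degree q) * b ^ (?m - 1))"
      using norm_resultant_le[OF pz _ a, of "of_int_poly q" b] q b by (simp add: c_def mult_ac)
    also have "\<dots> \<le> norm (poly (of_int_poly q) z) * ((1 + (\<Sum>n<?m. c n)) * b ^ (?m - 1))"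
    proof (intro mult_left_mono mult_right_mono)
      have "c (degree q) \<le> (\<Sum>n<?m. c n)" using q c by (intro member_le_sum) auto
      then show "c (degree q) \<le> 1 + (\<Sum>n<?m. c n)" by simp
    qed (use b0 in auto)
    finally show "1 \<le> (1 + (\<Sum>n<?m. c n)) * b ^ (?m - 1) * norm (poly (of_int_poly q) z)"
      by (simp add: mult_ac)
  qed
qed

section \<open>Minimal polynomials of algebraic integers\<close>

lemma ex_denominator: "\<exists>(d::int) r. d > 0 \<and> Polynomial.smult (of_int d) q = of_int_poly r" for q :: "rat poly"
proof (induction q)
  case 0
  show ?case by (intro exI[of _ 1] exI[of _ 0]) simp
next
  case (pCons a q)
  then obtain d r where dr: "d > 0" "Polynomial.smult (of_int d) q = of_int_poly r" by blast
  obtain m n where a: "a = of_int m / of_int n" "n > 0" by (metis Fract_of_int_quotient Rat_cases)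
  have "Polynomial.smult (of_int (n * d)) q = of_int_poly (Polynomial.smult n r)"
    by (simp add: of_int_hom.map_poly_hom_smult flip: dr(2))
  then have "Polynomial.smult (of_int (n * d)) (pCons a q) = of_int_poly (pCons (m * d) (Polynomial.smult n r))"
    using a by (simp add: of_int_hom.map_poly_pCons_hom mult.commute)
  moreover have "n * d > 0" using a(2) dr(1) by simp
  ultimately show ?case by blast
qed

text \<open>Gauss's lemma: after clearing denominators by \<open>d\<close> and \<open>e\<close>, the
  contents multiply to \<open>d * e\<close>. Each content divides the leading coefficient,
  \<open>d\<close> or \<open>e\<close>, so \<open>d\<close> divides all of \<open>p'\<close> and
  cancels.\<close>

lemma monic_factor_of_int_poly:
  fixes p q :: "rat poly" and f :: "int poly"
  assumes pq: "p * q = of_int_poly f" and p: "lead_coeff p = 1" and f: "lead_coeff f = 1"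
  shows "\<exists>r. p = of_int_poly r"
proof -
  have q: "lead_coeff q = 1" using arg_cong[OF pq, of lead_coeff] p f by (simp add: lead_coeff_mult)
  obtain d p' where p': "d > 0" "Polynomial.smult (of_int d) p = of_int_poly p'" using ex_denominator by blast
  obtain e q' where q': "e > 0" "Polynomial.smult (of_int e) q = of_int_poly q'" using ex_denominator by blast
  have "(of_int_poly (p' * q') :: rat poly) = of_int_poly (Polynomial.smult (d * e) f)"
    by (simp add: of_int_poly_hom.hom_mult of_int_hom.map_poly_hom_smult flip: p' q' pq) (simp add: mult_ac)
  then have "p' * q' = Polynomial.smult (d * e) f" by simp
  then have "content p' * content q' = d * e * content f"
    using p'(1) q'(1) by (metis content_mult content_smult abs_of_pos normalize_int_def mult_pos_pos)
  moreover have "content f = 1"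
    using content_dvd_coeff[of f "degree f"] f by (metis is_unit_normalize normalize_content)
  moreover have dvd: "content p' dvd d" "content q' dvd e"
    using content_dvd_coeff[of p' "degree p"] content_dvd_coeff[of q' "degree q"]
      arg_cong[OF p'(2), of "\<lambda>u. coeff u (degree p)"] arg_cong[OF q'(2), of "\<lambda>u. coeff u (degree q)"] p q
    by simp_all
  ultimately have prod: "content p' * content q' = d * e" by simp
  have "d dvd content p'"
  proof -
    obtain u where u: "e = content q' * u" using dvd(2) by blast
    then have "content p' * content q' = (d * u) * content q'" using prod by (simp add: mult_ac)
    moreover have "content q' \<noteq> 0" using u q'(1) by auto
    ultimately have "content p' = d * u" by simp
    then show ?thesis by simp
  qed
  then have "[:d:] dvd p'" by (meson const_poly_dvd_iff content_dvd_coeff dvd_trans)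
  then obtain r where "p' = Polynomial.smult d r" by (auto elim!: dvdE)
  then have "Polynomial.smult (of_int d) p = Polynomial.smult (of_int d) (of_int_poly r)"
    using p'(2) by (simp add: of_int_hom.map_poly_hom_smult)
  then have "p = of_int_poly r" using p'(1) by (metis of_int_0_eq_iff less_irrefl smult_cancel)
  then show ?thesis by blast
qed

lemma irreducible_dvd_of_common_root:
  fixes p f :: "rat poly" and x :: "'a::field_char_0"
  assumes irr: "irreducible p" and p: "poly (map_poly of_rat p) x = 0" and f: "poly (map_poly of_rat f) x = 0"
  shows "p dvd f"
proof (rule ccontr)
  assume "\<not> p dvd f"
  then have "gcd p f = 1"
    using irr irreducible_imp_prime_elem prime_elem_imp_coprime by (metis coprime_imp_gcd_eq_1)
  then obtain u v where "u * p + v * f = 1" by (metis bezout_coefficients_fst_snd)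
  then have "poly (map_poly of_rat (u * p + v * f)) x = 1" by simp
  then show False using p f by (simp add: poly_map_of_rat_add poly_map_of_rat_mult)
qed

text \<open>The minimal polynomial divides a monic integer polynomial vanishing at \<open>x\<close>,
  so it has integer coefficients by Gauss's lemma.\<close>

lemma min_poly_algebraic_int:
  fixes x :: "'a::field_char_0"
  assumes x: "algebraic_int x"
  shows "\<exists>P::int poly. min_poly x = of_int_poly P \<and> irreducible (of_int_poly P :: rat poly) \<and>
    lead_coeff P = 1 \<and> poly (of_int_poly P) x = 0"
proof -
  have "algebraic x" using x by (rule algebraic_int_imp_algebraic)
  then have mp: "irreducible (min_poly x)" "lead_coeff (min_poly x) = 1" "poly (map_poly of_rat (min_poly x)) x = 0"
    using theI'[OF ex1_min_poly, of x] unfolding min_poly_def by auto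
  obtain f :: "int poly" where f: "lead_coeff f = 1" "poly (of_int_poly f) x = 0"
    using x by (auto simp: algebraic_int_altdef_ipoly)
  have rat: "map_poly of_rat (of_int_poly g :: rat poly) = (of_int_poly g :: 'a poly)" for g
    by (simp add: map_poly_map_poly o_def)
  have "min_poly x dvd of_int_poly f"
    using irreducible_dvd_of_common_root[OF mp(1,3)] f by (simp add: rat)
  then obtain q where "min_poly x * q = of_int_poly f" by (metis dvdE)
  then obtain P where P: "min_poly x = of_int_poly P"
    using monic_factor_of_int_poly mp(2) f(1) by blast
  then show ?thesis using mp by (intro exI[of _ P]) (simp add: rat)
qed

section \<open>Dividing a linear recurrence by a root\<close>

text \<open>For a root \<open>z\<close> of \<open>p\<close>, the shift operator applied to \<open>p\<close> factors as
  \<open>(shift - z) \<circ> quotient_operator p z\<close>.\<close>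

definition quotient_operator :: "'a::comm_ring_1 poly \<Rightarrow> 'a \<Rightarrow> (nat \<Rightarrow> 'a) \<Rightarrow> 'a" where
  "quotient_operator p z u = (\<Sum>j<degree p. poly (poly_shift (Suc j) p) z * u j)"

text \<open>Horner's step of synthetic division: at a root \<open>z\<close> the values
  \<open>poly (poly_shift (Suc j) p) z\<close> are the coefficients of p / (x - z).\<close>

lemma poly_poly_shift: "poly (poly_shift j p) z = coeff p j + z * poly (poly_shift (Suc j) p) z"
proof -
  have "poly_shift j p = pCons (coeff p j) (poly_shift (Suc j) p)"
    by (rule poly_eqI) (simp add: coeff_poly_shift coeff_pCons split: nat.splits)
  then show ?thesis by simp
qed

text \<open>Horner's step combines the two sums, and the end terms vanish because
  \<open>poly p z = 0\<close> and the shift past the degree is 0. Where \<open>u\<close> obeys the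
  recurrence of \<open>p\<close>, shifting thus multiplies by \<open>z\<close>.\<close>

lemma quotient_operator_shift:
  assumes "poly p z = 0"
  shows "quotient_operator p z (\<lambda>j. u (Suc j)) = z * quotient_operator p z u + (\<Sum>j\<le>degree p. coeff p j * u j)"
proof -
  let ?s = "degree p" and ?r = "\<lambda>j. poly (poly_shift j p) z"
  have r_top: "?r (Suc ?s) = 0"
    by (subst poly_altdef) (simp add: coeff_poly_shift coeff_eq_0)
  have step: "z * ?r (Suc j) * w + coeff p j * w = ?r j * w" for j w
    by (subst poly_poly_shift[of j]) (simp add: algebra_simps)
  have "?r 0 = 0" using assms by (simp add: poly_shift_0)
  have "z * quotient_operator p z u + (\<Sum>j\<le>?s. coeff p j * u j) =
      (\<Sum>j\<le>?s. z * ?r (Suc j) * u j) + (\<Sum>j\<le>?s. coeff p j * u j)"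
    by (simp add: quotient_operator_def sum_distrib_left mult_ac r_top flip: lessThan_Suc_atMost)
  also have "\<dots> = (\<Sum>j\<le>?s. ?r j * u j)"
    unfolding sum.distrib[symmetric] by (rule sum.cong[OF refl step])
  also have "\<dots> = (\<Sum>j<?s. ?r (Suc j) * u (Suc j))"
    unfolding lessThan_Suc_atMost[symmetric] sum.lessThan_Suc_shift using \<open>?r 0 = 0\<close> by simp
  finally show ?thesis by (simp add: quotient_operator_def)
qed

text \<open>On powers of \<open>x\<close> the shift multiplies the operator's value by
  \<open>x\<close>, but also by \<open>z\<close> because \<open>p\<close> annihilates them; as
  \<open>x\<close> and \<open>z\<close> differ, the value is 0.\<close>

lemma quotient_operator_power:
  fixes x z :: "'a::idom"
  assumes "poly p z = 0" "poly p x = 0" "x \<noteq> z"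
  shows "quotient_operator p z (\<lambda>j. c * x ^ (k + j)) = 0"
proof -
  have lin: "quotient_operator p z (\<lambda>j. b * v j) = b * quotient_operator p z v" for b v
    by (simp add: quotient_operator_def sum_distrib_left mult_ac)
  have "x * quotient_operator p z (\<lambda>j. x ^ j) = z * quotient_operator p z (\<lambda>j. x ^ j)"
    using quotient_operator_shift[OF assms(1), of "\<lambda>j. x ^ j"] assms(2) lin[of x "\<lambda>j. x ^ j"]
    by (simp flip: poly_altdef)
  then have "quotient_operator p z (\<lambda>j. x ^ j) = 0" using assms(3) by simp
  then show ?thesis using lin[of "c * x ^ k" "\<lambda>j. x ^ j"] by (simp add: power_add mult_ac)
qed

text \<open>Puts the operator's value on integer sequences in the form required by
  \<open>int_poly_root_lower_bound\<close>. Only j = 0 contributes to the top coefficient, which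
  certifies that \<open>Q\<close> is nonzero for monic \<open>P\<close> and nonzero
  \<open>m 0\<close>.\<close>

lemma quotient_operator_of_int:
  fixes P :: "int poly" and m :: "nat \<Rightarrow> int"
  defines "Q \<equiv> \<Sum>j<degree P. Polynomial.smult (m j) (poly_shift (Suc j) P)"
  shows "quotient_operator (of_int_poly P) z (\<lambda>j. of_int (m j)) = poly (of_int_poly Q) (z::'a::{comm_ring_1,ring_char_0})"
    and "degree P > 0 \<Longrightarrow> degree Q < degree P"
    and "degree P > 0 \<Longrightarrow> coeff Q (degree P - 1) = m 0 * lead_coeff P"
    and "\<bar>coeff Q i\<bar> \<le> (\<Sum>i\<le>degree P. \<bar>coeff P i\<bar>) * (\<Sum>j<degree P. \<bar>m j\<bar>)"
proof -
  let ?s = "degree P"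
  have coeff_Q: "coeff Q i = (\<Sum>j<?s. m j * coeff P (i + Suc j))" for i
    by (simp add: Q_def coeff_sum coeff_poly_shift)
  have shift: "of_int_poly (poly_shift j P) = poly_shift j (of_int_poly P :: 'a poly)" for j
    by (rule poly_eqI) (simp add: coeff_poly_shift)
  show "quotient_operator (of_int_poly P) z (\<lambda>j. of_int (m j)) = poly (of_int_poly Q) z"
    by (simp add: quotient_operator_def Q_def of_int_poly_hom.hom_sum of_int_hom.map_poly_hom_smult
        poly_sum shift mult.commute)
  have le: "\<bar>coeff P i\<bar> \<le> (\<Sum>i\<le>?s. \<bar>coeff P i\<bar>)" for i
    by (cases "i \<le> ?s") (auto simp: coeff_eq_0 intro!: member_le_sum sum_nonneg)
  have "\<bar>coeff Q i\<bar> \<le> (\<Sum>j<?s. \<bar>m j\<bar> * (\<Sum>i\<le>?s. \<bar>coeff P i\<bar>))"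
    unfolding coeff_Q by (rule order_trans[OF sum_abs]) (auto simp: abs_mult intro!: sum_mono mult_left_mono le)
  then show "\<bar>coeff Q i\<bar> \<le> (\<Sum>i\<le>?s. \<bar>coeff P i\<bar>) * (\<Sum>j<?s. \<bar>m j\<bar>)"
    by (simp add: mult.commute flip: sum_distrib_right)
  assume s: "?s > 0"
  have "coeff Q i = 0" if "i > ?s - 1" for i
    unfolding coeff_Q using that by (intro sum.neutral) (auto simp: coeff_eq_0)
  then show "degree Q < ?s" using s degree_le[of "?s - 1" Q] by auto
  have "coeff Q (?s - 1) = (\<Sum>j\<in>{0}. m j * coeff P (?s - 1 + Suc j))"
    unfolding coeff_Q using s by (intro sum.mono_neutral_right) (auto simp: coeff_eq_0)
  then show "coeff Q (?s - 1) = m 0 * lead_coeff P" using s by simp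
qed

section \<open>Decay from bounded gaps\<close>

text \<open>Restarting the search just after each large value multiplies the position by roughly
  \<beta>, so about log_\<beta> (N / E) large values lie below \<open>N\<close>.\<close>

lemma decay_of_bounded_gaps:
  fixes f :: "nat \<Rightarrow> real"
  assumes \<beta>: "\<beta> \<ge> 2" and E: "E > 0" and \<delta>: "\<delta> \<ge> 0" and N: "N > 0"
    and gap: "\<And>A. \<exists>k\<ge>A. \<delta> \<le> f k \<and> real k + 1 \<le> \<beta> * real A + E"
  shows "exp (- (\<Sum>k<N. (f k)\<^sup>2)) \<le> exp (\<delta>\<^sup>2) * (E / real N) powr (\<delta>\<^sup>2 / ln \<beta>)"
proof -
  \<comment> \<open>Adding \<open>E\<close> to the position turns the affine growth into a geometric
    one.\<close>
  have count: "\<exists>A. real A + E \<le> \<beta> ^ n * E \<and> real n * \<delta>\<^sup>2 \<le> (\<Sum>k<A. (f k)\<^sup>2)" for n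
  proof (induction n)
    case 0
    show ?case by (rule exI[of _ 0]) simp
  next
    case (Suc n)
    then obtain A where A: "real A + E \<le> \<beta> ^ n * E" "real n * \<delta>\<^sup>2 \<le> (\<Sum>k<A. (f k)\<^sup>2)" by blast
    obtain k where k: "k \<ge> A" "\<delta> \<le> f k" "real k + 1 \<le> \<beta> * real A + E" using gap by blast
    have "real (Suc k) + E \<le> \<beta> * real A + 2 * E" using k(3) by simp
    \<comment> \<open>Here \<beta> \<ge> 2 absorbs the second \<open>E\<close>.\<close>
    also have "\<dots> \<le> \<beta> * (real A + E)" using \<beta> E by (simp add: algebra_simps)
    also have "\<dots> \<le> \<beta> * (\<beta> ^ n * E)" using A(1) \<beta> by (intro mult_left_mono) auto
    finally have "real (Suc k) + E \<le> \<beta> ^ Suc n * E" by simp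
    moreover have "real (Suc n) * \<delta>\<^sup>2 \<le> (\<Sum>j<Suc k. (f j)\<^sup>2)"
    proof -
      have "(\<Sum>j<A. (f j)\<^sup>2) \<le> (\<Sum>j<k. (f j)\<^sup>2)" using k(1) by (intro sum_mono2) auto
      moreover have "\<delta>\<^sup>2 \<le> (f k)\<^sup>2" using k(2) \<delta> by (intro power_mono)
      ultimately show ?thesis using A(2) by (simp add: algebra_simps)
    qed
    ultimately show ?case by blast
  qed
  have lnb: "ln \<beta> > 0" using \<beta> by simp
  \<comment> \<open>Rounding \<open>x\<close> down loses at most one large value, which costs the
    factor \<open>exp (\<delta>\<^sup>2)\<close>. For \<open>x < 0\<close> the bound is
    trivial.\<close>
  define x where "x = log \<beta> (real N / E)"
  have sum_ge: "\<delta>\<^sup>2 * (x - 1) \<le> (\<Sum>k<N. (f k)\<^sup>2)"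
  proof (cases "x \<ge> 0")
    case True
    obtain A where A: "real A + E \<le> \<beta> ^ nat \<lfloor>x\<rfloor> * E" "real (nat \<lfloor>x\<rfloor>) * \<delta>\<^sup>2 \<le> (\<Sum>k<A. (f k)\<^sup>2)"
      using count by blast
    have "\<beta> ^ nat \<lfloor>x\<rfloor> = \<beta> powr real (nat \<lfloor>x\<rfloor>)" using \<beta> by (simp add: powr_realpow)
    also have "\<dots> \<le> \<beta> powr x" using \<beta> True by (intro powr_mono) auto
    also have "\<dots> = real N / E" unfolding x_def using \<beta> E N by (intro powr_log_cancel) auto
    finally have "\<beta> ^ nat \<lfloor>x\<rfloor> * E \<le> real N" using E by (simp add: field_simps)
    then have "A \<le> N" using A(1) E by linarith
    then have "(\<Sum>k<A. (f k)\<^sup>2) \<le> (\<Sum>k<N. (f k)\<^sup>2)" by (intro sum_mono2) auto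
    moreover have "\<delta>\<^sup>2 * (x - 1) \<le> \<delta>\<^sup>2 * real (nat \<lfloor>x\<rfloor>)"
      using True by (intro mult_left_mono) (linarith, simp)
    ultimately show ?thesis using A(2) by (simp add: mult.commute)
  next
    case False
    then have "\<delta>\<^sup>2 * (x - 1) \<le> 0" by (simp add: mult_nonneg_nonpos)
    also have "\<dots> \<le> (\<Sum>k<N. (f k)\<^sup>2)" by (simp add: sum_nonneg)
    finally show ?thesis .
  qed
  have "exp (- (\<Sum>k<N. (f k)\<^sup>2)) \<le> exp (\<delta>\<^sup>2 + (\<delta>\<^sup>2 / ln \<beta>) * ln (E / real N))"
    using sum_ge E N unfolding x_def log_def by (simp add: ln_div algebra_simps diff_divide_distrib)
  also have "\<dots> = exp (\<delta>\<^sup>2) * (E / real N) powr (\<delta>\<^sup>2 / ln \<beta>)"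
    using E N by (simp add: exp_add powr_def)
  finally show ?thesis .
qed

section \<open>Distance to the nearest integer and reduction to t \<ge> 1\<close>

lemma dist_int_eq_round: "dist_int x = \<bar>x - of_int (round x)\<bar>"
proof -
  have "infdist x \<int> = (INF a\<in>\<int>. dist x a)" unfolding infdist_def by (auto simp: Ints_def)
  moreover have "(INF a\<in>\<int>. dist x a) \<le> dist x (of_int (round x))"
    by (intro cINF_lower bdd_belowI[of _ 0]) auto
  moreover have "dist x (of_int (round x)) \<le> (INF a\<in>\<int>. dist x a)"
  proof (rule cINF_greatest)
    show "dist x (of_int (round x)) \<le> dist x a" if "a \<in> \<int>" for a
      using that round_diff_minimal[of x] by (auto elim!: Ints_cases simp: dist_real_def)
  qed (use Ints_0 in blast)
  ultimately show ?thesis by (simp add: dist_int_def dist_real_def)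
qed

lemma decay_bounds_mono:
  assumes "decay_bounds \<theta> C \<alpha> \<beta>" "C \<le> C'"
  shows "decay_bounds \<theta> C' \<alpha> \<beta>"
proof -
  have "C * x \<le> C' * x" if "x \<ge> 0" for x using assms(2) that by (rule mult_right_mono)
  then have "C * (ln (1 + t)) powr (1 / ln \<beta>) * real N powr (-\<alpha>) \<le> C' * (ln (1 + t)) powr (1 / ln \<beta>) * real N powr (-\<alpha>)"
     "C * real N powr (-\<alpha>) \<le> C' * real N powr (-\<alpha>)" for t N
    by (simp_all add: mult_right_mono)
  then show ?thesis using assms(1) unfolding decay_bounds_def by (meson order_trans)
qed

text \<open>For \<open>t < 1\<close>, discarding the first \<open>k = \<lceil>ln (1 / t) / ln \<theta>\<rceil> \<le> N / 2\<close> terms replaces \<open>t\<close>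
  by \<open>t * \<theta> ^ k \<in> [1, \<theta>)\<close>.\<close>

lemma decay_bounds_of_ge_1:
  assumes \<theta>: "\<theta> > 1" and \<alpha>: "\<alpha> \<ge> 0" and \<beta>: "\<beta> > 1" and C: "C \<ge> 0"
    and le: "\<And>t N. t \<ge> 1 \<Longrightarrow> N \<ge> 1 \<Longrightarrow> exp (- (\<Sum>k<N. (dist_int (t * \<theta> ^ k))\<^sup>2))
          \<le> C * (ln (1 + t)) powr (1 / ln \<beta>) * real N powr (-\<alpha>)"
  shows "\<exists>C'>0. decay_bounds \<theta> C' \<alpha> \<beta>"
proof -
  \<comment> \<open>\<open>D\<close> collects ln (1 + t \<theta>^k) \<le> ln (1 + \<theta>) and the
    factor 2^\<alpha> from N - k \<ge> N / 2.\<close>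
  define D where "D = C * ln (1 + \<theta>) powr (1 / ln \<beta>) * 2 powr \<alpha>"
  have "decay_bounds \<theta> (C + D + 1) \<alpha> \<beta>"
    unfolding decay_bounds_def
  proof (intro conjI allI impI; elim conjE)
    fix t :: real and N :: nat assume "t \<ge> 1" "N \<ge> 1"
    then have "exp (- (\<Sum>k<N. (dist_int (t * \<theta> ^ k))\<^sup>2)) \<le> C * (ln (1 + t)) powr (1 / ln \<beta>) * real N powr (-\<alpha>)"
      by (rule le)
    also have "\<dots> \<le> (C + D + 1) * (ln (1 + t)) powr (1 / ln \<beta>) * real N powr (-\<alpha>)"
      using C by (intro mult_right_mono) (auto simp: D_def)
    finally show "exp (- (\<Sum>k<N. (dist_int (t * \<theta> ^ k))\<^sup>2)) \<le>
        (C + D + 1) * (ln (1 + t)) powr (1 / ln \<beta>) * real N powr (-\<alpha>)" .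
  next
    fix t :: real and N :: nat
    assume t: "0 < t" "t < 1" and N: "2 * \<lceil>ln (1 / t) / ln \<theta>\<rceil> \<le> int N"
    define k where "k = nat \<lceil>ln (1 / t) / ln \<theta>\<rceil>"
    have pos: "0 < ln (1 / t) / ln \<theta>" using t \<theta> by (intro divide_pos_pos) (simp_all add: ln_div)
    then have ceil: "int k = \<lceil>ln (1 / t) / ln \<theta>\<rceil>" unfolding k_def by simp
    \<comment> \<open>With 2 k \<le> N this leaves N - k \<ge> 1 terms, as \<open>le\<close>
      requires.\<close>
    then have k1: "k \<ge> 1" using pos by linarith
    have k_ge: "ln (1 / t) / ln \<theta> \<le> real k" and k_lt: "real k < ln (1 / t) / ln \<theta> + 1"
      using ceil ceiling_correct[of "ln (1 / t) / ln \<theta>"] by linarith+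
    have kN: "2 * k \<le> N" using ceil N by linarith
    have "t * \<theta> ^ k = exp (ln t + real k * ln \<theta>)" using t \<theta> by (simp add: exp_add exp_of_nat_mult)
    moreover have "0 \<le> ln t + real k * ln \<theta>" "ln t + real k * ln \<theta> \<le> ln \<theta>"
      using k_ge k_lt \<theta> t by (auto simp: ln_div field_simps)
    ultimately have t': "1 \<le> t * \<theta> ^ k" "t * \<theta> ^ k \<le> \<theta>"
      using \<theta> by (simp_all add: exp_le_cancel_iff flip: ln_ge_iff)
    have "(\<Sum>i<N - k. (dist_int (t * \<theta> ^ k * \<theta> ^ i))\<^sup>2) = (\<Sum>i\<in>{k..<N}. (dist_int (t * \<theta> ^ i))\<^sup>2)"
      using kN by (intro sum.reindex_bij_witness[where i = "\<lambda>i. i - k" and j = "\<lambda>i. i + k"])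
        (auto simp: power_add mult_ac)
    also have "\<dots> \<le> (\<Sum>i<N. (dist_int (t * \<theta> ^ i))\<^sup>2)" by (intro sum_mono2) auto
    finally have "exp (- (\<Sum>i<N. (dist_int (t * \<theta> ^ i))\<^sup>2)) \<le> exp (- (\<Sum>i<N - k. (dist_int (t * \<theta> ^ k * \<theta> ^ i))\<^sup>2))"
      by simp
    also have "\<dots> \<le> C * (ln (1 + t * \<theta> ^ k)) powr (1 / ln \<beta>) * real (N - k) powr (-\<alpha>)"
      using t' k1 kN by (intro le) auto
    also have "\<dots> \<le> C * (ln (1 + \<theta>)) powr (1 / ln \<beta>) * (real N / 2) powr (-\<alpha>)"
      using t' k1 kN C \<alpha> \<beta> by (intro mult_mono mult_left_mono powr_mono2 powr_mono2') auto
    also have "\<dots> = D * real N powr (-\<alpha>)"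
      unfolding D_def by (simp add: powr_divide powr_minus field_simps)
    also have "\<dots> \<le> (C + D + 1) * real N powr (-\<alpha>)" using C by (intro mult_right_mono) auto
    finally show "exp (- (\<Sum>i<N. (dist_int (t * \<theta> ^ i))\<^sup>2)) \<le> (C + D + 1) * real N powr (-\<alpha>)" .
  qed
  moreover have "C + D + 1 > 0" using C by (simp add: D_def add_nonneg_pos)
  ultimately show ?thesis by blast
qed

section \<open>Stretches of small distances to the integers\<close>

text \<open>Over the stretch \<open>Y\<close> grows by \<open>z ^ L\<close> yet stays bounded, so
  the resultant lower bound at its start limits \<open>L\<close>. The window has
  \<open>degree P\<close> further indices because the recurrence at \<open>k\<close> looks that far
  ahead.\<close>

lemma good_stretch_bound:
  fixes P :: "int poly" and \<theta> :: real and z :: complex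
  assumes irr: "irreducible (of_int_poly P :: rat poly)" and monic: "lead_coeff P = 1"
    and P\<theta>: "poly (of_int_poly P) \<theta> = 0" and Pz: "poly (of_int_poly P) z = 0"
    and z: "z \<noteq> of_real \<theta>" and \<theta>: "\<theta> \<ge> 1"
    and \<delta>: "\<delta> * (\<Sum>i\<le>degree P. \<bar>real_of_int (coeff P i)\<bar>) \<le> 1"
  shows "\<exists>K\<ge>1. \<forall>t\<ge>1. \<forall>A L. (\<forall>k\<in>{A..A + L + degree P}. dist_int (t * \<theta> ^ k) < \<delta>) \<longrightarrow>
    norm z ^ L \<le> K * (t * \<theta> ^ A) ^ (degree P - 1)"
proof -
  let ?s = "degree P"
  let ?p = "of_int_poly P :: complex poly"
  have P\<theta>c: "poly ?p (of_real \<theta>) = 0"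
  proof -
    have "poly ?p (of_real \<theta>) = of_real (poly (of_int_poly P) \<theta>)" by (simp add: poly_altdef)
    then show ?thesis using P\<theta> by simp
  qed
  have s: "?s > 0"
  proof (rule ccontr)
    assume "\<not> ?s > 0"
    then obtain a where "P = [:a:]" by (auto elim: degree_eq_zeroE)
    then show False using monic Pz by auto
  qed
  define S where "S = (\<Sum>i\<le>?s. \<bar>coeff P i\<bar>)"
  obtain c where c: "c > 0" and c_le: "\<And>(q::int poly) b. q \<noteq> 0 \<Longrightarrow> degree q < ?s \<Longrightarrow>
      (\<And>i. \<bar>real_of_int (coeff q i)\<bar> \<le> b) \<Longrightarrow> 1 \<le> c * b ^ (?s - 1) * norm (poly (of_int_poly q) z)"
    using int_poly_root_lower_bound[OF irr Pz] by auto
  \<comment> \<open>\<open>K1\<close> bounds every \<open>Y k\<close> since rounding errors are at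
    most 1; \<open>B\<close> bounds the coefficients of \<open>Q\<close> relative to t \<theta>^A,
    using m \<le> 2 t \<theta>^k.\<close>
  define K1 where "K1 = (\<Sum>j<?s. norm (poly (poly_shift (Suc j) ?p) z))"
  define B where "B = real_of_int S * (real ?s * (2 * \<theta> ^ ?s))"
  have K1: "K1 \<ge> 0" unfolding K1_def by (intro sum_nonneg) auto
  have S: "S \<ge> 0" unfolding S_def by (intro sum_nonneg) auto
  have B: "B \<ge> 0" unfolding B_def using S \<theta> by simp
  define K where "K = c * B ^ (?s - 1) * K1 + 1"
  have K: "K \<ge> 1" unfolding K_def using c B K1 by simp
  have "norm z ^ L \<le> K * (t * \<theta> ^ A) ^ (?s - 1)"
    if t: "t \<ge> 1" and good: "\<And>k. A \<le> k \<Longrightarrow> k \<le> A + L + ?s \<Longrightarrow> dist_int (t * \<theta> ^ k) < \<delta>" for t A L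
  proof -
    define m where "m k = round (t * \<theta> ^ k)" for k
    define e where "e k = t * \<theta> ^ k - of_int (m k)" for k
    have ge1: "t * \<theta> ^ k \<ge> 1" for k
      using mult_mono[of 1 t 1 "\<theta> ^ k"] t \<theta> by (simp add: one_le_power)
    have e_small: "\<bar>e k\<bar> < \<delta>" if "A \<le> k" "k \<le> A + L + ?s" for k
      using good[OF that] by (simp add: e_def m_def dist_int_eq_round)
    have e_le: "\<bar>e k\<bar> \<le> 1" for k
      using of_int_round_abs_le[of "t * \<theta> ^ k"] by (simp add: e_def m_def abs_minus_commute)
    have m_ge: "m k \<ge> 1" for k
      unfolding m_def using round_mono[OF ge1[of k]] by simp
    have m_le: "real_of_int (m k) \<le> 2 * (t * \<theta> ^ k)" for k
      using e_le[of k] ge1[of k] unfolding e_def by linarith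
    define Y where "Y k = quotient_operator ?p z (\<lambda>j. of_int (m (k + j)))" for k
    \<comment> \<open>As \<theta> is a root, this integer equals minus the same combination of the
      errors, which is below 1 in modulus; the leading coefficient 1 makes that strict.\<close>
    have rec: "(\<Sum>j\<le>?s. coeff P j * m (k + j)) = 0" if k: "A \<le> k" "k \<le> A + L" for k
    proof -
      have "(\<Sum>j\<le>?s. real_of_int (coeff P j) * (t * \<theta> ^ (k + j))) = t * \<theta> ^ k * poly (of_int_poly P) \<theta>"
        by (simp add: poly_altdef sum_distrib_left power_add mult_ac)
      then have "(\<Sum>j\<le>?s. real_of_int (coeff P j) * (t * \<theta> ^ (k + j))) = 0" using P\<theta> by simp
      then have "real_of_int (\<Sum>j\<le>?s. coeff P j * m (k + j)) = - (\<Sum>j\<le>?s. real_of_int (coeff P j) * e (k + j))"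
        by (simp add: e_def algebra_simps sum_subtractf)
      also have "\<bar>\<dots>\<bar> \<le> (\<Sum>j\<le>?s. \<bar>real_of_int (coeff P j)\<bar> * \<bar>e (k + j)\<bar>)"
        unfolding abs_minus_cancel by (rule order_trans[OF sum_abs]) (simp add: abs_mult)
      also have "\<dots> < (\<Sum>j\<le>?s. \<bar>real_of_int (coeff P j)\<bar> * \<delta>)"
      proof (rule sum_strict_mono_ex1)
        show "\<forall>j\<in>{..?s}. \<bar>real_of_int (coeff P j)\<bar> * \<bar>e (k + j)\<bar> \<le> \<bar>real_of_int (coeff P j)\<bar> * \<delta>"
          using k by (intro ballI mult_left_mono less_imp_le[OF e_small]) auto
        show "\<exists>j\<in>{..?s}. \<bar>real_of_int (coeff P j)\<bar> * \<bar>e (k + j)\<bar> < \<bar>real_of_int (coeff P j)\<bar> * \<delta>"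
          using k monic by (intro bexI[of _ ?s]) (auto intro!: e_small)
      qed simp
      also have "\<dots> \<le> 1" using \<delta> by (simp add: mult.commute flip: sum_distrib_left)
      finally show ?thesis by linarith
    qed
    have Y_Suc: "Y (Suc k) = z * Y k" if "A \<le> k" "k \<le> A + L" for k
    proof -
      have "(\<Sum>j\<le>degree ?p. coeff ?p j * of_int (m (k + j))) = of_int (\<Sum>j\<le>?s. coeff P j * m (k + j))"
        by simp
      also have "\<dots> = 0" using rec[OF that] by simp
      finally show ?thesis
        using quotient_operator_shift[OF Pz, of "\<lambda>j. of_int (m (k + j))"] by (simp add: Y_def)
    qed
    have Y_pow: "Y (A + i) = z ^ i * Y A" if "i \<le> L" for i
      using that by (induction i) (simp_all add: Y_Suc)
    have Y_le: "norm (Y k) \<le> K1" for k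
    proof -
      \<comment> \<open>The operator kills t \<theta>^k, leaving only the errors; this holds outside
        the stretch too.\<close>
      have "Y k + quotient_operator ?p z (\<lambda>j. of_real (e (k + j))) =
          quotient_operator ?p z (\<lambda>j. of_real t * of_real \<theta> ^ (k + j))"
        unfolding Y_def quotient_operator_def sum.distrib[symmetric]
        by (rule sum.cong) (simp_all add: e_def algebra_simps)
      then have "Y k = - quotient_operator ?p z (\<lambda>j. of_real (e (k + j)))"
        using quotient_operator_power[OF Pz P\<theta>c z[symmetric]] by (simp add: add_eq_0_iff2)
      then show ?thesis
        unfolding K1_def quotient_operator_def using e_le
        by (auto intro!: sum_norm_le simp: norm_mult mult_left_le)
    qed
    define Q where "Q = (\<Sum>j<?s. Polynomial.smult (m (A + j)) (poly_shift (Suc j) P))"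
    note Q = quotient_operator_of_int[where P = P and m = "\<lambda>j. m (A + j)", folded Q_def]
    have "coeff Q (?s - 1) \<noteq> 0" using Q(3)[OF s] m_ge[of A] monic by simp
    then have "Q \<noteq> 0" by auto
    moreover have "\<bar>real_of_int (coeff Q i)\<bar> \<le> B * (t * \<theta> ^ A)" for i
    proof -
      have "real_of_int \<bar>coeff Q i\<bar> \<le> real_of_int (S * (\<Sum>j<?s. \<bar>m (A + j)\<bar>))"
        unfolding S_def of_int_le_iff by (rule Q(4))
      also have "\<dots> = real_of_int S * (\<Sum>j<?s. real_of_int \<bar>m (A + j)\<bar>)" by simp
      also have "\<dots> \<le> real_of_int S * (\<Sum>j<?s. 2 * \<theta> ^ ?s * (t * \<theta> ^ A))"
      proof (intro mult_left_mono sum_mono)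
        fix j assume j: "j \<in> {..<?s}"
        have "real_of_int \<bar>m (A + j)\<bar> \<le> 2 * (t * \<theta> ^ (A + j))" using m_le[of "A + j"] m_ge[of "A + j"] by simp
        also have "\<dots> \<le> 2 * (t * \<theta> ^ (A + ?s))"
          using j t \<theta> by (intro mult_left_mono power_increasing) auto
        finally show "real_of_int \<bar>m (A + j)\<bar> \<le> 2 * \<theta> ^ ?s * (t * \<theta> ^ A)" by (simp add: power_add mult_ac)
      qed (use S in auto)
      finally show ?thesis by (simp add: B_def mult_ac)
    qed
    ultimately have "1 \<le> c * (B * (t * \<theta> ^ A)) ^ (?s - 1) * norm (Y A)"
      using c_le[of Q "B * (t * \<theta> ^ A)"] Q(2)[OF s] Q(1)[of z] by (simp add: Y_def)
    then have "norm z ^ L * 1 \<le> norm z ^ L * (c * (B * (t * \<theta> ^ A)) ^ (?s - 1) * norm (Y A))"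
      by (intro mult_left_mono) auto
    also have "\<dots> = c * B ^ (?s - 1) * norm (Y (A + L)) * (t * \<theta> ^ A) ^ (?s - 1)"
      by (simp add: Y_pow norm_mult norm_power power_mult_distrib mult_ac)
    also have "\<dots> \<le> K * (t * \<theta> ^ A) ^ (?s - 1)"
    proof (intro mult_right_mono)
      have "c * B ^ (?s - 1) * norm (Y (A + L)) \<le> c * B ^ (?s - 1) * K1"
        using Y_le c B by (intro mult_left_mono) auto
      then show "c * B ^ (?s - 1) * norm (Y (A + L)) \<le> K" by (simp add: K_def)
    qed (use ge1[of A] in simp)
    finally show ?thesis by simp
  qed
  then show ?thesis using K by (intro exI[of _ K]) simp
qed

text \<open>Choosing \<open>L\<close> just large enough to violate the stretch bound forces an index
  with distance at least \<delta> in the window. Taking logarithms, this \<open>L\<close> is linear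
  in \<open>A\<close> and ln t.\<close>

lemma bounded_gaps:
  fixes \<theta> w K \<delta> :: real and s :: nat
  assumes \<theta>: "\<theta> > 1" and w: "w > 1" and K: "K \<ge> 1"
    and stretch: "\<forall>t\<ge>1. \<forall>A L. (\<forall>k\<in>{A..A + L + s}. dist_int (t * \<theta> ^ k) < \<delta>) \<longrightarrow>
      w ^ L \<le> K * (t * \<theta> ^ A) ^ (s - 1)"
    and \<beta>: "\<beta> \<ge> 1 + real s * ln \<theta> / ln w"
  shows "\<exists>c>0. \<forall>t\<ge>1. \<forall>A. \<exists>k\<ge>A. \<delta> \<le> dist_int (t * \<theta> ^ k) \<and> real k + 1 \<le> \<beta> * real A + c * ln (1 + t)"
proof -
  have lnw: "ln w > 0" and ln\<theta>: "ln \<theta> > 0" using w \<theta> by simp_all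
  \<comment> \<open>The 2 in \<open>c1\<close> is one for rounding \<open>L\<close> up and one for
    \<open>real k + 1\<close>. The constant \<open>c1\<close> is later absorbed using ln 2 \<le> ln
    (1 + t).\<close>
  define c1 where "c1 = real s + 2 + ln K / ln w"
  define c2 where "c2 = real (s - 1) / ln w"
  have c1: "c1 > 0" unfolding c1_def using K lnw by (simp add: add_pos_nonneg)
  have c2: "c2 \<ge> 0" unfolding c2_def using lnw by simp
  define c where "c = c1 / ln 2 + c2"
  have c: "c > 0" unfolding c_def using c1 c2 by (simp add: add_pos_nonneg)
  have "\<exists>k\<ge>A. \<delta> \<le> dist_int (t * \<theta> ^ k) \<and> real k + 1 \<le> \<beta> * real A + c * ln (1 + t)" if t: "t \<ge> 1" for t A
  proof -
    define X where "X = ln K + real (s - 1) * (ln t + real A * ln \<theta>)"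
    have X: "X \<ge> 0" unfolding X_def using K t ln\<theta> by simp
    define L where "L = nat \<lfloor>X / ln w\<rfloor> + 1"
    have "X / ln w \<ge> 0" using X lnw by simp
    then have L: "X / ln w < real L" "real L \<le> X / ln w + 1" unfolding L_def by linarith+
    have pos: "t * \<theta> ^ A > 0" using t \<theta> by simp
    have "K * (t * \<theta> ^ A) ^ (s - 1) = exp X"
      using K t \<theta> pos by (simp add: X_def exp_add exp_of_nat_mult flip: ln_mult ln_realpow)
    also have "\<dots> < exp (real L * ln w)" using L(1) lnw by (simp add: field_simps)
    also have "\<dots> = w ^ L" using w by (simp add: exp_of_nat_mult)
    finally obtain k where k: "A \<le> k" "k \<le> A + L + s" "\<delta> \<le> dist_int (t * \<theta> ^ k)"
      using stretch t by (meson atLeastAtMost_iff not_le)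
    have "real k + 1 \<le> real A + (X / ln w + 1) + real s + 1" using k(2) L(2) by linarith
    also have "\<dots> = c1 + c2 * ln t + (1 + real (s - 1) * ln \<theta> / ln w) * real A"
      using lnw by (simp add: c1_def c2_def X_def add_divide_distrib algebra_simps)
    also have "\<dots> \<le> c1 + c2 * ln t + \<beta> * real A"
    proof -
      have "real (s - 1) * ln \<theta> / ln w \<le> real s * ln \<theta> / ln w"
        using lnw ln\<theta> by (intro divide_right_mono mult_right_mono) auto
      then have "(1 + real (s - 1) * ln \<theta> / ln w) * real A \<le> \<beta> * real A"
        using \<beta> by (intro mult_right_mono) auto
      then show ?thesis by simp
    qed
    also have "c1 + c2 * ln t \<le> c * ln (1 + t)"
    proof -
      have "ln 2 \<le> ln (1 + t)" "ln t \<le> ln (1 + t)" using t by simp_all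
      then have "c1 / ln 2 * ln 2 \<le> c1 / ln 2 * ln (1 + t)" "c2 * ln t \<le> c2 * ln (1 + t)"
        using c1 c2 by (intro mult_left_mono; simp)+
      then show ?thesis by (simp add: c_def algebra_simps)
    qed
    finally show ?thesis using k by (intro exI[of _ k]) simp
  qed
  then show ?thesis using c by blast
qed

section \<open>Explicit exponents and a common constant\<close>

lemma decay_bounds_conjugate:
  assumes \<theta>: "\<theta> > 1" and int: "algebraic_int \<theta>"
    and conj: "galois_conjugate \<theta> z" and z: "z \<noteq> of_real \<theta>" and norm_z: "norm z > 1"
  shows "conj_alpha \<theta> z > 0 \<and> conj_beta \<theta> z > 0 \<and>
    (\<exists>C>0. decay_bounds \<theta> C (conj_alpha \<theta> z) (conj_beta \<theta> z))"
proof -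
  obtain P :: "int poly" where mp: "min_poly \<theta> = of_int_poly P" and irr: "irreducible (of_int_poly P :: rat poly)"
    and monic: "lead_coeff P = 1" and P\<theta>: "poly (of_int_poly P) \<theta> = 0"
    using min_poly_algebraic_int[OF int] by blast
  let ?s = "degree P" and ?\<beta> = "conj_beta \<theta> z"
  define H where "H = (of_rat (poly_height (min_poly \<theta>)) :: real)"
  have deg: "degree (min_poly \<theta>) = ?s" using mp by simp
  have Pz: "poly (of_int_poly P) z = 0"
    using conj by (simp add: galois_conjugate_def mp map_poly_map_poly o_def)
  have s: "?s > 0" using irr by (auto simp: irreducible_def is_unit_iff_degree)
  have height: "\<bar>real_of_int (coeff P i)\<bar> \<le> H" if "i \<le> ?s" for i
  proof -
    have "\<bar>coeff (min_poly \<theta>) i\<bar> \<le> poly_height (min_poly \<theta>)"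
      unfolding poly_height_def deg using that by (intro Max_ge) auto
    then have "(of_rat \<bar>coeff (min_poly \<theta>) i\<bar> :: real) \<le> H" unfolding H_def by (simp only: of_rat_less_eq)
    then show ?thesis by (simp add: mp flip: of_int_abs)
  qed
  \<comment> \<open>The leading coefficient contributes 1 and the \<open>?s\<close> others at most
    \<open>H\<close> each, so this is small enough for \<open>good_stretch_bound\<close>.\<close>
  define \<delta> where "\<delta> = 1 / (1 + real ?s * H)"
  have H: "H \<ge> 1" using height[of ?s] monic by simp
  have \<delta>: "0 < \<delta>" "\<delta> \<le> 1" unfolding \<delta>_def using H by (auto simp: add_pos_nonneg)
  have "(\<Sum>i\<le>?s. \<bar>real_of_int (coeff P i)\<bar>) = (\<Sum>i<?s. \<bar>real_of_int (coeff P i)\<bar>) + 1"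
    using monic by (simp flip: lessThan_Suc_atMost)
  also have "\<dots> \<le> 1 + real ?s * H"
    using sum_bounded_above[of "{..<?s}" "\<lambda>i. \<bar>real_of_int (coeff P i)\<bar>" H] height by simp
  finally have "\<delta> * (\<Sum>i\<le>?s. \<bar>real_of_int (coeff P i)\<bar>) \<le> 1"
    unfolding \<delta>_def using H by (simp add: divide_le_eq add_pos_nonneg)
  then obtain K where K: "K \<ge> 1" and stretch: "\<forall>t\<ge>1. \<forall>A L. (\<forall>k\<in>{A..A + L + ?s}. dist_int (t * \<theta> ^ k) < \<delta>) \<longrightarrow>
      norm z ^ L \<le> K * (t * \<theta> ^ A) ^ (?s - 1)"
    using good_stretch_bound[OF irr monic P\<theta> Pz z less_imp_le[OF \<theta>]] by metis
  define x where "x = real ?s * ln \<theta> / ln (norm z)"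
  have "x > 0" unfolding x_def using s \<theta> ln_gt_zero[OF norm_z] by (intro divide_pos_pos mult_pos_pos) auto
  \<comment> \<open>The ceiling of a positive number is at least 1.\<close>
  then have \<beta>: "?\<beta> \<ge> 2" and \<beta>_ge: "?\<beta> \<ge> 1 + x"
    using le_of_int_ceiling[of x] by (simp_all add: conj_beta_def deg flip: x_def)
  obtain c where c: "c > 0" and gap: "\<And>t A. t \<ge> 1 \<Longrightarrow>
      \<exists>k\<ge>A. \<delta> \<le> dist_int (t * \<theta> ^ k) \<and> real k + 1 \<le> ?\<beta> * real A + c * ln (1 + t)"
    using bounded_gaps[OF \<theta> norm_z K stretch \<beta>_ge[unfolded x_def]] by metis
  define \<alpha> where "\<alpha> = \<delta>\<^sup>2 / ln ?\<beta>"
  have \<alpha>_eq: "conj_alpha \<theta> z = \<alpha>"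
    by (simp add: conj_alpha_def \<alpha>_def \<delta>_def deg H_def power_int_minus power_one_over inverse_eq_divide)
  have ln\<beta>: "ln ?\<beta> > 0" using \<beta> by simp
  have \<alpha>: "\<alpha> > 0" unfolding \<alpha>_def using \<delta> ln\<beta> by simp
  have "\<alpha> \<le> 1 / ln ?\<beta>" unfolding \<alpha>_def using \<delta> ln\<beta> by (intro divide_right_mono power_le_one) auto
  \<comment> \<open>The gap count yields ln (1 + t) to the power \<alpha> \<le> 1 / ln \<beta>;
    since ln (1 + t) \<ge> ln 2, raising the exponent costs only the power of ln 2.\<close>
  define D where "D = exp (\<delta>\<^sup>2) * c powr \<alpha> * ln 2 powr (\<alpha> - 1 / ln ?\<beta>)"
  have "exp (- (\<Sum>k<N. (dist_int (t * \<theta> ^ k))\<^sup>2)) \<le> D * (ln (1 + t)) powr (1 / ln ?\<beta>) * real N powr (-\<alpha>)"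
    if t: "t \<ge> 1" and N: "N \<ge> 1" for t and N :: nat
  proof -
    have lnt: "ln 2 \<le> ln (1 + t)" using t by simp
    then have pos: "ln (1 + t) > 0" using ln_gt_zero[of 2] by linarith
    have "exp (- (\<Sum>k<N. (dist_int (t * \<theta> ^ k))\<^sup>2)) \<le> exp (\<delta>\<^sup>2) * (c * ln (1 + t) / real N) powr \<alpha>"
      unfolding \<alpha>_def using c pos \<delta> N by (intro decay_of_bounded_gaps[OF \<beta> _ _ _ gap[OF t]]) auto
    also have "\<dots> = exp (\<delta>\<^sup>2) * c powr \<alpha> * (ln (1 + t) powr (1 / ln ?\<beta>) * ln (1 + t) powr (\<alpha> - 1 / ln ?\<beta>)) * real N powr (-\<alpha>)"
      unfolding powr_add[symmetric] using c pos N by (simp add: powr_mult powr_divide powr_minus field_simps)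
    also have "\<dots> \<le> exp (\<delta>\<^sup>2) * c powr \<alpha> * (ln (1 + t) powr (1 / ln ?\<beta>) * ln 2 powr (\<alpha> - 1 / ln ?\<beta>)) * real N powr (-\<alpha>)"
      using lnt \<open>\<alpha> \<le> 1 / ln ?\<beta>\<close> by (intro mult_right_mono mult_left_mono powr_mono2') auto
    finally show ?thesis by (simp add: D_def mult_ac)
  qed
  then have "\<exists>C>0. decay_bounds \<theta> C \<alpha> ?\<beta>"
    using \<theta> \<alpha> \<beta> by (intro decay_bounds_of_ge_1[of _ _ _ D]) (auto simp: D_def)
  then show ?thesis using \<alpha> \<beta> by (simp add: \<alpha>_eq)
qed

theorem proposition5p5:
  fixes \<theta> :: real
  assumes "\<theta> > 1" and "algebraic_int \<theta>"
    and "\<exists>\<theta>\<^sub>2::complex. galois_conjugate \<theta> \<theta>\<^sub>2 \<and> \<theta>\<^sub>2 \<noteq> of_real \<theta> \<and> norm \<theta>\<^sub>2 > 1"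
  shows "(\<exists>C>0. \<exists>\<alpha>>0. \<exists>\<beta>>0. decay_bounds \<theta> C \<alpha> \<beta>) \<and>
    (\<exists>C>0. \<forall>\<theta>\<^sub>2::complex. galois_conjugate \<theta> \<theta>\<^sub>2 \<and> \<theta>\<^sub>2 \<noteq> of_real \<theta> \<and> norm \<theta>\<^sub>2 > 1 \<longrightarrow>
        conj_alpha \<theta> \<theta>\<^sub>2 > 0 \<and> conj_beta \<theta> \<theta>\<^sub>2 > 0 \<and>
        decay_bounds \<theta> C (conj_alpha \<theta> \<theta>\<^sub>2) (conj_beta \<theta> \<theta>\<^sub>2))"
proof -
  define Z where "Z = {z::complex. galois_conjugate \<theta> z \<and> z \<noteq> of_real \<theta> \<and> norm z > 1}"
  have Z: "conj_alpha \<theta> z > 0 \<and> conj_beta \<theta> z > 0 \<and>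
      (\<exists>C>0. decay_bounds \<theta> C (conj_alpha \<theta> z) (conj_beta \<theta> z))" if "z \<in> Z" for z
    using decay_bounds_conjugate[OF assms(1,2)] that unfolding Z_def by blast
  then obtain C where C: "\<And>z. z \<in> Z \<Longrightarrow> C z > 0"
      "\<And>z. z \<in> Z \<Longrightarrow> decay_bounds \<theta> (C z) (conj_alpha \<theta> z) (conj_beta \<theta> z)"
    by metis
  have "finite Z"
  proof -
    obtain P :: "int poly" where P: "min_poly \<theta> = of_int_poly P" "lead_coeff P = 1"
      using min_poly_algebraic_int[OF assms(2)] by blast
    have "Z \<subseteq> {z. poly (of_int_poly P) z = 0}"
      by (auto simp: Z_def galois_conjugate_def P(1) map_poly_map_poly o_def)
    moreover have "(of_int_poly P :: complex poly) \<noteq> 0" using P(2) by auto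
    ultimately show ?thesis using poly_roots_finite finite_subset by blast
  qed
  \<comment> \<open>The admissible conjugates are finitely many roots, so summing their constants
    gives one that serves all of them.\<close>
  define D where "D = (\<Sum>z\<in>Z. C z)"
  have D_ge: "C z \<le> D" if "z \<in> Z" for z
    unfolding D_def using \<open>finite Z\<close> C(1) that by (intro member_le_sum) (auto intro: less_imp_le)
  obtain z where "z \<in> Z" using assms(3) by (auto simp: Z_def)
  then have "D > 0" using D_ge C(1) by (meson less_le_trans)
  have "decay_bounds \<theta> D (conj_alpha \<theta> z) (conj_beta \<theta> z)" if "z \<in> Z" for z
    using decay_bounds_mono[OF C(2) D_ge] that by blast
  with Z \<open>D > 0\<close> \<open>z \<in> Z\<close> show ?thesis
    unfolding Z_def by blast
qed

end
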